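(* Let $n>1$ be an integer and let $\mathcal{L}\subset\mathbb{R}^n$ be the second order cone. The following statements hold: $$\mathcal{Z}(\mathcal{L})^\circ=str(\mathcal{Z}(\mathcal{L}))=\mathbb{R}\,\mathrm{I}-J\big(str(\mathcal{E}_{\partial(\mathcal{L})})+\mathcal{A}^n\big)$$ and $$\partial(\mathcal{Z}(\mathcal{L}))=\mathbb{R}\,\mathrm{I}-J\big(\partial_{*}(\mathcal{E}_{\partial(\mathcal{L})})+\mathcal{A}^n\big),$$ where $\partial_{*}(\mathcal{E}_{\partial(\mathcal{L})})$ denotes the boundary of $\mathcal{E}_{\partial(\mathcal{L})}$ in $\mathcal{S}^n$. Here, for a set $M$ of symmetric matrices, $\mathbb{R}\,\mathrm{I}-J(M+\mathcal{A}^n)=\{\theta\,\mathrm{I}-J(P+Q):\theta\in\mathbb{R},\ P\in M,\ Q\in\mathcal{A}^n\}$.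
   Context: $\mathbb{R}^n$ (column vectors) carries the usual inner product $\langle\cdot,\cdot\rangle$ and norm $\|\cdot\|$; $\mathbb{R}^{n\times n}$ carries the inner product $\langle X,Y\rangle=\operatorname{tr}(X^\top Y)$. The second order cone is $\mathcal{L}=\{(t,u)^\top : t\in\mathbb{R},\ u\in\mathbb{R}^{n-1},\ t\ge\|u\|\}$; it is self-dual, i.e. $\mathcal{L}^*:=\{x\in\mathbb{R}^n:\langle x,y\rangle\ge 0\ \forall y\in\mathcal{L}\}=\mathcal{L}$. Its boundary is $\partial(\mathcal{L})=\{(t,u)^\top: t=\|u\|\}$. A matrix $A\in\mathbb{R}^{n\times n}$ is a $\mathcal{Z}$-transformation on $\mathcal{L}$ if $\langle Ax,y\rangle\le 0$ whenever $x\in\mathcal{L}$, $y\in\mathcal{L}^*=\mathcal{L}$ and $\langle x,y\rangle=0$. $\mathcal{Z}(\mathcal{L})\subseteq\mathbb{R}^{n\times n}$ denotes the set of all $\mathcal{Z}$-transformations on $\mathcal{L}$; $\mathcal{Z}(\mathcal{L})^\circ$ and $\partial(\mathcal{Z}(\mathcal{L}))$ denote its interior and boundary in $\mathbb{R}^{n\times n}$. A matrix $A\in\mathbb{R}^{n\times n}$ is a strict-$\mathcal{Z}$-transformation on $\mathcal{L}$ if $\langle Ax,y\rangle<0$ whenever $x,y\in\mathcal{L}$ are both nonzero and $\langle x,y\rangle=0$; $str(\mathcal{Z}(\mathcal{L}))$ denotes the set of all such matrices. $\mathrm{I}$ is the $n\times n$ identity matrix and $J=\operatorname{diag}(1,-1,-1,\ldots,-1)\in\mathbb{R}^{n\times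 n}$. $\mathcal{S}^n$ is the space of real symmetric $n\times n$ matrices and $\mathcal{A}^n$ is the space of real skew-symmetric $n\times n$ matrices. $\mathcal{E}_{\partial(\mathcal{L})}=\{P\in\mathcal{S}^n: x^\top Px\ge 0\ \forall x\in\partial(\mathcal{L})\}$ is the copositive cone of $\partial(\mathcal{L})$, and $str(\mathcal{E}_{\partial(\mathcal{L})})=\{P\in\mathcal{S}^n: \langle Px,x\rangle>0\ \text{for all } 0\ne x\in\partial(\mathcal{L})\}$ is the set of symmetric matrices strictly copositive on $\partial(\mathcal{L})$. *)

theory Defs
  imports "HOL-Analysis.Analysis"
begin

text \<open>
  Vectors in \<open>R^n\<close> are of type \<open>real ^ 'n\<close> with \<open>n = CARD('n)\<close>. A finite index type has no
  preferred first element, so the index \<open>k\<close> of the coordinate \<open>t\<close> in \<open>(t, u)\<close> is a parameter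
  of the definitions; \<open>u\<close> consists of the remaining \<open>n - 1\<close> coordinates.
\<close>

definition soc :: "'n \<Rightarrow> (real ^ 'n::finite) set" where
  "soc k = {x. x $ k \<ge> L2_set (\<lambda>i. x $ i) (- {k})}"

definition dual_cone :: "'a::real_inner set \<Rightarrow> 'a set" where
  "dual_cone K = {x. \<forall>y\<in>K. x \<bullet> y \<ge> 0}"

definition Z_trans :: "(real ^ 'n::finite) set \<Rightarrow> (real ^ 'n ^ 'n) set" where
  "Z_trans K = {A. \<forall>x\<in>K. \<forall>y\<in>dual_cone K. x \<bullet> y = 0 \<longrightarrow> (A *v x) \<bullet> y \<le> 0}"

text \<open>Both vectors range over the cone itself: the notion is meant for self-dual cones.\<close>

definition strict_Z_trans :: "(real ^ 'n::finite) set \<Rightarrow> (real ^ 'n ^ 'n) set" where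
  "strict_Z_trans K =
     {A. \<forall>x\<in>K. \<forall>y\<in>K. x \<noteq> 0 \<longrightarrow> y \<noteq> 0 \<longrightarrow> x \<bullet> y = 0 \<longrightarrow> (A *v x) \<bullet> y < 0}"

definition Jmat :: "'n \<Rightarrow> real ^ 'n ^ 'n::finite" where
  "Jmat k = (\<chi> i j. if i = j then (if i = k then 1 else - 1) else 0)"

definition sym_matrices :: "(real ^ 'n ^ 'n::finite) set" where
  "sym_matrices = {P. transpose P = P}"

definition skew_matrices :: "(real ^ 'n ^ 'n::finite) set" where
  "skew_matrices = {Q. transpose Q = - Q}"

definition copositive :: "(real ^ 'n::finite) set \<Rightarrow> (real ^ 'n ^ 'n) set" where
  "copositive S = {P \<in> sym_matrices. \<forall>x\<in>S. x \<bullet> (P *v x) \<ge> 0}"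

definition strict_copositive :: "(real ^ 'n::finite) set \<Rightarrow> (real ^ 'n ^ 'n) set" where
  "strict_copositive S = {P \<in> sym_matrices. \<forall>x\<in>S. x \<noteq> 0 \<longrightarrow> (P *v x) \<bullet> x > 0}"

lemma frontier_soc:
  fixes k :: "'n::finite"
  shows "frontier (soc k) = {x. x $ k = L2_set (\<lambda>i. x $ i) (- {k})}"
proof -
  let ?g = "\<lambda>x::real^'n. x $ k - L2_set (\<lambda>i. x $ i) (- {k})"
  have cont: "continuous_on UNIV ?g"
    unfolding L2_set_def by (intro continuous_intros)
  have eq: "soc k = {x. 0 \<le> ?g x}" by (auto simp: soc_def)
  have closed: "closed (soc k)"
    unfolding eq by (intro closed_Collect_le continuous_on_const cont)
  have "open {x. 0 < ?g x}"
    by (intro open_Collect_less continuous_on_const cont)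
  then have 1: "{x. 0 < ?g x} \<subseteq> interior (soc k)"
    by (intro interior_maximal) (auto simp: eq)
  have 2: "x \<notin> interior (soc k)" if "?g x = 0" for x
  proof
    assume "x \<in> interior (soc k)"
    then obtain e where e: "e > 0" "ball x e \<subseteq> soc k"
      by (meson mem_interior)
    let ?y = "x - (e/2) *\<^sub>R axis k 1"
    have "?y \<in> ball x e" using e by (simp add: dist_norm)
    then have "?y \<in> {x. 0 \<le> ?g x}" using e(2) unfolding eq by blast
    then have "0 \<le> ?g ?y" by blast
    moreover have "L2_set (\<lambda>i. ?y $ i) (- {k}) = L2_set (\<lambda>i. x $ i) (- {k})"
      by (rule L2_set_cong) (auto simp: axis_def)
    moreover have "?y $ k = x $ k - e/2" by (simp add: axis_def)
    ultimately show False using that e(1) by simp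
  qed
  have "soc k - interior (soc k) = {x. ?g x = 0}"
  proof (intro set_eqI iffI)
    fix x assume "x \<in> soc k - interior (soc k)"
    then have "0 \<le> ?g x" "\<not> 0 < ?g x" using 1 eq by auto
    then show "x \<in> {x. ?g x = 0}" by simp
  next
    fix x assume "x \<in> {x. ?g x = 0}"
    then show "x \<in> soc k - interior (soc k)" using 2[of x] eq by auto
  qed
  then show ?thesis
    unfolding frontier_def using closed by (simp add: closure_closed)
qed

lemma dual_cone_soc:
  fixes k :: "'n::finite"
  shows "dual_cone (soc k) = soc k"
proof (intro set_eqI iffI)
  have inner: "x \<bullet> y = x $ k * y $ k + (\<Sum>i\<in>- {k}. x $ i * y $ i)" for x y :: "real ^ 'n"
    unfolding inner_vec_def inner_real_def
    by (subst sum.remove[of _ k]) (auto simp: Compl_eq_Diff_UNIV)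
  fix x :: "real ^ 'n"
  let ?s = "L2_set (\<lambda>i. x $ i) (- {k})"
  show "x \<in> dual_cone (soc k)" if x: "x \<in> soc k"
    unfolding dual_cone_def
  proof (intro CollectI ballI)
    fix y assume y: "y \<in> soc k"
    have "- (\<Sum>i\<in>- {k}. x $ i * y $ i) \<le> (\<Sum>i\<in>- {k}. \<bar>x $ i\<bar> * \<bar>y $ i\<bar>)"
      unfolding sum_negf[symmetric] by (intro sum_mono) (simp flip: abs_mult)
    also have "\<dots> \<le> ?s * L2_set (\<lambda>i. y $ i) (- {k})"
      by (rule L2_set_mult_ineq)
    also have "\<dots> \<le> x $ k * y $ k"
      using x y by (intro mult_mono) (auto simp: soc_def intro: order_trans[OF L2_set_nonneg])
    finally show "0 \<le> x \<bullet> y" by (simp add: inner)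
  qed
  show "x \<in> soc k" if x: "x \<in> dual_cone (soc k)"
  proof (cases "?s = 0")
    case True
    have "L2_set (\<lambda>i. axis k (1::real) $ i) (- {k}) = L2_set (\<lambda>i. 0) (- {k})"
      by (rule L2_set_cong) (auto simp: axis_def)
    then have "axis k 1 \<in> soc k" by (simp add: soc_def L2_set_def)
    then have "0 \<le> x \<bullet> axis k 1" using x unfolding dual_cone_def by blast
    then show ?thesis using True by (simp add: soc_def inner_axis)
  next
    case False
    define z where "z = (\<chi> i. if i = k then ?s else - x $ i)"
    have "L2_set (\<lambda>i. z $ i) (- {k}) = ?s"
      unfolding L2_set_def z_def by (intro arg_cong[where f = sqrt] sum.cong) auto
    moreover have "z $ k = ?s" by (simp add: z_def)
    ultimately have "z \<in> soc k" unfolding soc_def by simp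
    then have "0 \<le> x \<bullet> z" using x unfolding dual_cone_def by blast
    also have "x \<bullet> z = x $ k * ?s + (\<Sum>i\<in>- {k}. - (x $ i)\<^sup>2)"
      unfolding inner by (intro arg_cong2[where f = "(+)"] sum.cong)
        (auto simp: z_def power2_eq_square)
    also have "(\<Sum>i\<in>- {k}. - (x $ i)\<^sup>2) = - ?s * ?s"
      by (simp add: L2_set_def sum_negf sum_nonneg)
    finally have "0 \<le> (x $ k - ?s) * ?s" by (simp add: algebra_simps)
    moreover have "0 < ?s" using False L2_set_nonneg[of "\<lambda>i. x $ i" "- {k}"] by linarith
    ultimately show ?thesis by (simp add: soc_def zero_le_mult_iff)
  qed
qed

end

theory Submission imports Defs begin

text \<open>
  Everything is a statement about one quadratic form. On the second order cone two nonzero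
  vectors \<open>x\<close>, \<open>y\<close> can be orthogonal only if \<open>x\<close> lies on the boundary and \<open>y\<close> is a positive
  multiple of \<open>J x\<close> (\<open>orthogonal_in_soc\<close>). Hence \<open>\<langle>A x, y\<rangle>\<close> is, up to a positive factor,
  \<open>x\<^sup>T J A x\<close>, and \<open>A\<close> is a (strict) Z-transformation iff the form of \<open>B = - J A\<close> is nonnegative
  (positive) on the nonzero boundary vectors.

  Interior and boundary are then those of the cone of matrices whose form is nonnegative on a
  closed cone \<open>S\<close>. The matrices with positive form are an open set, because the unit vectors
  of \<open>S\<close> form a compact set; conversely, if \<open>B - \<epsilon> I\<close> still has a nonnegative form, then the form
  of \<open>B\<close> is at least \<open>\<epsilon> \<parallel>x\<parallel>\<^sup>2\<close>. As \<open>I\<close> is symmetric, the same argument works among all matrices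
  and among the symmetric ones. Since \<open>A \<mapsto> - J A\<close> is a linear involution, it transports
  interiors, and therefore boundaries.

  For the parametrisation, \<open>A = \<theta> I - J (P + Q)\<close> means \<open>- J A = P + Q - \<theta> J\<close>. On boundary vectors
  the skew part \<open>Q\<close> and \<open>J\<close> have zero form, so \<open>P\<close> and \<open>- J A\<close> satisfy the same conditions
  there; in the other direction \<open>P\<close> is taken to be the symmetric part of \<open>- J A\<close>, with \<open>\<theta> = 0\<close>.
\<close>

section \<open>Quadratic forms of matrices\<close>

lemma matrix_vector_mult_uminus_left: "(- A) *v x = - (A *v x)"
  for A :: "real ^ 'n::finite ^ 'm::finite"
  using matrix_vector_mult_diff_rdistrib[of 0 A x] by simp

lemma scaleR_matrix_vector_mult: "(c *\<^sub>R A) *v x = c *\<^sub>R (A *v x)"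
  for A :: "real ^ 'n::finite ^ 'm::finite"
  by (simp add: scaleR_matrix_vector_assoc)

lemma quadratic_form_transpose: "x \<bullet> (transpose A *v x) = x \<bullet> (A *v x)"
  for A :: "real ^ 'n::finite ^ 'n"
  by (metis dot_lmul_matrix inner_commute transpose_matrix_vector)

lemma quadratic_form_skew: "x \<bullet> (Q *v x) = 0" if "Q \<in> skew_matrices"
proof -
  have "transpose Q = - Q" using that by (simp add: skew_matrices_def)
  then show ?thesis
    using quadratic_form_transpose[of x Q]
    by (simp only: matrix_vector_mult_uminus_left inner_minus_right)
qed

section \<open>The cone of forms nonnegative on a given set\<close>

definition form_nonneg :: "(real ^ 'n::finite) set \<Rightarrow> (real ^ 'n ^ 'n) set" where
  "form_nonneg S = {B. \<forall>x\<in>S. 0 \<le> x \<bullet> (B *v x)}"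

definition form_pos :: "(real ^ 'n::finite) set \<Rightarrow> (real ^ 'n ^ 'n) set" where
  "form_pos S = {B. \<forall>x\<in>S. x \<noteq> 0 \<longrightarrow> 0 < x \<bullet> (B *v x)}"

lemma copositive_eq: "copositive S = sym_matrices \<inter> form_nonneg S"
  by (auto simp: copositive_def form_nonneg_def)

lemma strict_copositive_eq: "strict_copositive S = sym_matrices \<inter> form_pos S"
  by (auto simp: strict_copositive_def form_pos_def inner_commute)

lemma form_pos_subset_form_nonneg: "form_pos S \<subseteq> form_nonneg S"
  by (fastforce simp: form_pos_def form_nonneg_def)

lemma closed_form_nonneg: "closed (form_nonneg S)"
proof -
  have "form_nonneg S = (\<Inter>x\<in>S. {B. 0 \<le> x \<bullet> (B *v x)})"
    by (auto simp: form_nonneg_def)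
  moreover have "closed {B :: real ^ 'a ^ 'a. 0 \<le> x \<bullet> (B *v x)}" for x
    by (intro closed_Collect_le)
      (auto simp: inner_vec_def matrix_vector_mult_def intro!: continuous_intros)
  ultimately show ?thesis by auto
qed

text \<open>
  By homogeneity only the unit vectors of \<open>S\<close> matter. They form a compact set, so the matrices
  whose form fails to be positive at one of them are the projection of a closed set along a
  compact factor.
\<close>

lemma open_form_pos:
  assumes "closed S" and cone: "\<And>c x. c > 0 \<Longrightarrow> x \<in> S \<Longrightarrow> c *\<^sub>R x \<in> S"
  shows "open (form_pos S)"
proof -
  let ?U = "S \<inter> sphere 0 1"
  let ?T = "{p :: (real ^ 'a) \<times> (real ^ 'a ^ 'a). fst p \<bullet> (snd p *v fst p) \<le> 0}"
  have "closed ?T"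
    by (intro closed_Collect_le)
      (auto simp: inner_vec_def matrix_vector_mult_def intro!: continuous_intros)
  moreover have "compact ?U"
    using assms(1) by (intro closed_Int_compact) auto
  ultimately have "closed {B. \<exists>x. x \<in> ?U \<and> (x, B) \<in> ?T}"
    by (rule closed_compact_projection[rotated])
  moreover have "- form_pos S = {B. \<exists>x. x \<in> ?U \<and> (x, B) \<in> ?T}"
  proof (intro set_eqI iffI)
    fix B assume "B \<in> - form_pos S"
    then obtain x where x: "x \<in> S" "x \<noteq> 0" "x \<bullet> (B *v x) \<le> 0"
      by (auto simp: form_pos_def not_less)
    let ?c = "inverse (norm x)"
    have "?c *\<^sub>R x \<in> ?U"
      using x cone[of ?c x] by simp
    moreover have "(?c *\<^sub>R x) \<bullet> (B *v (?c *\<^sub>R x)) = (?c * ?c) * (x \<bullet> (B *v x))"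
      by (simp add: matrix_vector_mult_scaleR)
    then have "(?c *\<^sub>R x) \<bullet> (B *v (?c *\<^sub>R x)) \<le> 0"
      using x(3) by (simp only: mult_nonneg_nonpos zero_le_square)
    then have "(?c *\<^sub>R x, B) \<in> ?T" by simp
    ultimately show "B \<in> {B. \<exists>x. x \<in> ?U \<and> (x, B) \<in> ?T}" by blast
  next
    fix B assume "B \<in> {B. \<exists>x. x \<in> ?U \<and> (x, B) \<in> ?T}"
    then show "B \<in> - form_pos S"
      by (force simp: form_pos_def not_less)
  qed
  ultimately show ?thesis by (simp add: open_closed)
qed

text \<open>
  The ambient space \<open>V\<close> is a parameter because both the space of all matrices and the space of
  symmetric matrices are needed; the argument only perturbs in the direction of the identity.
\<close>

lemma interior_of_form_nonneg:
  assumes S: "closed S" "\<And>c x. c > 0 \<Longrightarrow> x \<in> S \<Longrightarrow> c *\<^sub>R x \<in> S"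
    and V: "\<And>B c. B \<in> V \<Longrightarrow> B - c *\<^sub>R mat 1 \<in> V"
  shows "top_of_set V interior_of (V \<inter> form_nonneg S) = V \<inter> form_pos S"
proof
  show "V \<inter> form_pos S \<subseteq> top_of_set V interior_of (V \<inter> form_nonneg S)"
    using form_pos_subset_form_nonneg[of S] open_form_pos[OF S]
    by (intro interior_of_maximal) (auto simp: openin_open_Int)
  show "top_of_set V interior_of (V \<inter> form_nonneg S) \<subseteq> V \<inter> form_pos S"
  proof
    fix B assume "B \<in> top_of_set V interior_of (V \<inter> form_nonneg S)"
    then obtain T where T: "open T" "B \<in> T" "B \<in> V" "V \<inter> T \<subseteq> form_nonneg S"
      by (auto simp: interior_of_def openin_open)
    have "((\<lambda>c. B - c *\<^sub>R mat 1) \<longlongrightarrow> B - 0 *\<^sub>R mat 1) (at_right 0)"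
      by (intro tendsto_intros)
    then have "\<forall>\<^sub>F c in at_right 0. B - c *\<^sub>R mat 1 \<in> T"
      using T(1,2) by (auto dest!: topological_tendstoD)
    then have "\<forall>\<^sub>F c in at_right (0::real). c > 0 \<and> B - c *\<^sub>R mat 1 \<in> T"
      using eventually_conj[OF eventually_at_right_less[of 0]] by blast
    then obtain c :: real where c: "c > 0" "B - c *\<^sub>R mat 1 \<in> T"
      using eventually_happens trivial_limit_at_right_real by blast
    then have "B - c *\<^sub>R mat 1 \<in> form_nonneg S"
      using V[OF T(3)] T(4) by blast
    then have "c * (x \<bullet> x) \<le> x \<bullet> (B *v x)" if "x \<in> S" for x
      using that by (auto simp: form_nonneg_def matrix_vector_mult_diff_rdistrib
          scaleR_matrix_vector_mult inner_diff_right)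
    moreover have "0 < c * (x \<bullet> x)" if "x \<noteq> 0" for x :: "real ^ 'a"
      using that c(1) by simp
    ultimately have "0 < x \<bullet> (B *v x)" if "x \<in> S" "x \<noteq> 0" for x
      using that by (meson less_le_trans)
    then have "B \<in> form_pos S" by (simp add: form_pos_def)
    then show "B \<in> V \<inter> form_pos S" using T(3) by blast
  qed
qed

corollary frontier_of_form_nonneg:
  assumes "closed S" "\<And>c x. c > 0 \<Longrightarrow> x \<in> S \<Longrightarrow> c *\<^sub>R x \<in> S"
    and "\<And>B c. B \<in> V \<Longrightarrow> B - c *\<^sub>R mat 1 \<in> V"
  shows "top_of_set V frontier_of (V \<inter> form_nonneg S) = V \<inter> (form_nonneg S - form_pos S)"
proof -
  have "top_of_set V closure_of (V \<inter> form_nonneg S) = V \<inter> form_nonneg S"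
    by (intro closure_of_closedin closedin_closed_Int closed_form_nonneg)
  then show ?thesis
    unfolding frontier_of_def using interior_of_form_nonneg[OF assms] by auto
qed

section \<open>The reflection and the geometry of the cone\<close>

lemma Jmat_mult_vec: "Jmat k *v x = (2 * x $ k) *\<^sub>R axis k 1 - x"
proof -
  have "(Jmat k *v x) $ i = ((2 * x $ k) *\<^sub>R axis k 1 - x) $ i" for i
  proof -
    have "(Jmat k *v x) $ i = (\<Sum>j\<in>UNIV. (Jmat k $ i $ j) * x $ j)"
      by (simp add: matrix_vector_mult_def)
    also have "\<dots> = (\<Sum>j\<in>UNIV. if j = i then (if i = k then 1 else - 1) * x $ i else 0)"
      by (rule sum.cong) (auto simp: Jmat_def)
    finally have "(Jmat k *v x) $ i = (\<Sum>j\<in>UNIV. if j = i then (if i = k then 1 else - 1) * x $ i else 0)" .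
    then show ?thesis by (simp add: axis_def)
  qed
  then show ?thesis by (simp add: vec_eq_iff)
qed

lemma Jmat_inner: "(Jmat k *v x) \<bullet> y = 2 * x $ k * y $ k - x \<bullet> y"
  by (simp add: Jmat_mult_vec inner_diff_left inner_axis')

lemma Jmat_self_adjoint: "(Jmat k *v x) \<bullet> y = x \<bullet> (Jmat k *v y)"
  using Jmat_inner[of k x y] Jmat_inner[of k y x] by (simp add: inner_commute)

lemma Jmat_involution_vec: "Jmat k *v (Jmat k *v x) = x"
  by (simp add: Jmat_mult_vec[of k "Jmat k *v x"]) (simp add: Jmat_mult_vec)

text \<open>The form of \<open>J\<close> is \<open>t\<^sup>2 - \<parallel>u\<parallel>\<^sup>2\<close>, so that it describes both the cone and its boundary.\<close>

lemma Jmat_form: "x \<bullet> (Jmat k *v x) = (x $ k)\<^sup>2 - (L2_set (\<lambda>i. x $ i) (- {k}))\<^sup>2"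
proof -
  have "x \<bullet> x = x $ k * x $ k + (\<Sum>i\<in>- {k}. x $ i * x $ i)"
    unfolding inner_vec_def inner_real_def
    by (subst sum.remove[of _ k]) (auto simp: Compl_eq_Diff_UNIV)
  then show ?thesis
    using Jmat_inner[of k x x]
    by (simp add: L2_set_def sum_nonneg power2_eq_square inner_commute)
qed

lemma soc_iff: "x \<in> soc k \<longleftrightarrow> 0 \<le> x $ k \<and> 0 \<le> x \<bullet> (Jmat k *v x)"
proof -
  let ?r = "L2_set (\<lambda>i. x $ i) (- {k})"
  have "?r \<le> x $ k \<longleftrightarrow> 0 \<le> x $ k \<and> ?r\<^sup>2 \<le> (x $ k)\<^sup>2"
    using L2_set_nonneg[of "\<lambda>i. x $ i" "- {k}"] power2_le_imp_le power_mono
    by (metis order_trans)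
  then show ?thesis by (simp add: soc_def Jmat_form)
qed

lemma frontier_soc_iff: "x \<in> frontier (soc k) \<longleftrightarrow> 0 \<le> x $ k \<and> x \<bullet> (Jmat k *v x) = 0"
proof -
  let ?r = "L2_set (\<lambda>i. x $ i) (- {k})"
  have eq: "x $ k = ?r \<longleftrightarrow> 0 \<le> x $ k \<and> ?r\<^sup>2 = (x $ k)\<^sup>2"
    using L2_set_nonneg[of "\<lambda>i. x $ i" "- {k}"] power2_eq_iff_nonneg by metis
  show ?thesis unfolding frontier_soc mem_Collect_eq Jmat_form eq by auto
qed

lemma scaleR_frontier_soc: "c > 0 \<Longrightarrow> x \<in> frontier (soc k) \<Longrightarrow> c *\<^sub>R x \<in> frontier (soc k)"
  by (auto simp: frontier_soc_iff matrix_vector_mult_scaleR)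

lemma soc_nonzero_coord_pos:
  assumes "x \<in> soc k" "x \<noteq> 0"
  shows "0 < x $ k"
proof (rule ccontr)
  assume "\<not> 0 < x $ k"
  then have "x $ k = 0" using assms(1) by (simp add: soc_iff)
  then have "x \<bullet> x \<le> 0"
    using assms(1) Jmat_inner[of k x x] by (simp add: soc_iff inner_commute)
  then show False using assms(2) inner_gt_zero_iff[of x] by linarith
qed

lemma Jmat_frontier_soc:
  assumes "x \<in> frontier (soc k)"
  shows "Jmat k *v x \<in> soc k"
proof -
  have "(Jmat k *v x) $ k = x $ k" by (simp add: Jmat_mult_vec)
  then show ?thesis
    using assms by (simp add: soc_iff frontier_soc_iff Jmat_involution_vec inner_commute)
qed

text \<open>
  For orthogonal \<open>x\<close>, \<open>y\<close> the squared length of \<open>z = y\<^sub>k J x - x\<^sub>k y\<close> expands to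
  \<open>- y\<^sub>k\<^sup>2 \<langle>x, J x\<rangle> - x\<^sub>k\<^sup>2 \<langle>y, J y\<rangle>\<close>, which is nonpositive on the cone. So \<open>z = 0\<close> and both
  terms vanish: this is the equality case of the Cauchy--Schwarz inequality.
\<close>

lemma orthogonal_in_soc:
  assumes x: "x \<in> soc k" "x \<noteq> 0" and y: "y \<in> soc k" "y \<noteq> 0" and orth: "x \<bullet> y = 0"
  obtains c where "c > 0" "y = c *\<^sub>R (Jmat k *v x)" "x \<in> frontier (soc k)"
proof -
  let ?J = "\<lambda>x. Jmat k *v x"
  define z where "z = y $ k *\<^sub>R ?J x - x $ k *\<^sub>R y"
  have pos: "0 < x $ k" "0 < y $ k" using soc_nonzero_coord_pos x y by blast+
  have 1: "?J x \<bullet> ?J x = 2 * (x $ k)\<^sup>2 - x \<bullet> ?J x"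
    using Jmat_inner[of k x x]
    by (simp add: Jmat_self_adjoint Jmat_involution_vec power2_eq_square)
  have 2: "y \<bullet> y = 2 * (y $ k)\<^sup>2 - y \<bullet> ?J y"
    using Jmat_inner[of k y y] by (simp add: inner_commute power2_eq_square)
  have 3: "?J x \<bullet> y = 2 * x $ k * y $ k" using orth by (simp add: Jmat_inner)
  have "z \<bullet> z = (y $ k)\<^sup>2 * (?J x \<bullet> ?J x) + (x $ k)\<^sup>2 * (y \<bullet> y) - 2 * x $ k * y $ k * (?J x \<bullet> y)"
    unfolding z_def
    by (simp add: inner_diff_left inner_diff_right inner_commute power2_eq_square algebra_simps)
  also have "\<dots> = - ((y $ k)\<^sup>2 * (x \<bullet> ?J x)) - (x $ k)\<^sup>2 * (y \<bullet> ?J y)"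
    unfolding 1 2 3 by (simp add: power2_eq_square algebra_simps)
  finally have zz: "z \<bullet> z = - ((y $ k)\<^sup>2 * (x \<bullet> ?J x)) - (x $ k)\<^sup>2 * (y \<bullet> ?J y)" .
  have "0 \<le> (y $ k)\<^sup>2 * (x \<bullet> ?J x)" "0 \<le> (x $ k)\<^sup>2 * (y \<bullet> ?J y)"
    using x(1) y(1) by (auto simp: soc_iff)
  with zz inner_ge_zero[of z] have "z \<bullet> z = 0" "(y $ k)\<^sup>2 * (x \<bullet> ?J x) = 0" by linarith+
  then have z0: "y $ k *\<^sub>R ?J x = x $ k *\<^sub>R y" and "x \<bullet> ?J x = 0"
    using pos by (auto simp: z_def)
  then have "x \<in> frontier (soc k)" using pos by (simp add: frontier_soc_iff)
  moreover have "y = (y $ k / x $ k) *\<^sub>R ?J x"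
  proof -
    have "(y $ k / x $ k) *\<^sub>R ?J x = inverse (x $ k) *\<^sub>R (y $ k *\<^sub>R ?J x)"
      by (simp add: divide_inverse mult.commute)
    also have "\<dots> = y" unfolding z0 using pos by simp
    finally show ?thesis ..
  qed
  ultimately show thesis using that[of "y $ k / x $ k"] pos by simp
qed

section \<open>Z-transformations as forms on the boundary\<close>

definition neg_J_mult :: "'n::finite \<Rightarrow> real ^ 'n ^ 'n \<Rightarrow> real ^ 'n ^ 'n" where
  "neg_J_mult k A = - (Jmat k ** A)"

lemma neg_J_mult_vec: "neg_J_mult k A *v x = - (Jmat k *v (A *v x))"
  by (simp add: neg_J_mult_def matrix_vector_mult_uminus_left matrix_vector_mul_assoc)

lemma neg_J_mult_form: "x \<bullet> (neg_J_mult k A *v x) = - ((A *v x) \<bullet> (Jmat k *v x))"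
  using Jmat_self_adjoint[of k x "A *v x"]
  by (simp add: neg_J_mult_vec inner_commute[of "A *v x"])

lemma linear_neg_J_mult: "linear (neg_J_mult k)"
  by (rule linearI)
    (simp_all add: matrix_eq neg_J_mult_vec matrix_vector_mult_add_rdistrib
      scaleR_matrix_vector_mult matrix_vector_mult_scaleR matrix_vector_right_distrib)

lemma neg_J_mult_involution: "neg_J_mult k (neg_J_mult k A) = A"
  by (simp add: matrix_eq neg_J_mult_vec vec.neg Jmat_involution_vec)

lemma bij_neg_J_mult: "bij (neg_J_mult k)"
  by (rule involuntory_imp_bij) (rule neg_J_mult_involution)

lemma interior_neg_J_mult_vimage: "interior (neg_J_mult k -` X) = neg_J_mult k -` interior X"
proof -
  have "neg_J_mult k -` Y = neg_J_mult k ` Y" for Y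
    by (rule set_eqI, rule iffI, metis vimageE image_eqI neg_J_mult_involution)
      (auto simp: neg_J_mult_involution)
  then show ?thesis
    using interior_bijective_linear_image[OF linear_neg_J_mult bij_neg_J_mult] by simp
qed

lemma Z_trans_soc: "Z_trans (soc k) = neg_J_mult k -` form_nonneg (frontier (soc k))"
proof (intro set_eqI iffI)
  fix A assume A: "A \<in> Z_trans (soc k)"
  have "(A *v x) \<bullet> (Jmat k *v x) \<le> 0" if "x \<in> frontier (soc k)" for x
    using that A Jmat_frontier_soc[OF that]
    unfolding Z_trans_def dual_cone_soc by (auto simp: frontier_soc_iff soc_iff)
  then show "A \<in> neg_J_mult k -` form_nonneg (frontier (soc k))"
    by (simp add: form_nonneg_def neg_J_mult_form)
next
  fix A assume "A \<in> neg_J_mult k -` form_nonneg (frontier (soc k))"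
  then have A: "(A *v x) \<bullet> (Jmat k *v x) \<le> 0" if "x \<in> frontier (soc k)" for x
    using that by (auto simp: form_nonneg_def neg_J_mult_form)
  have "(A *v x) \<bullet> y \<le> 0" if xy: "x \<in> soc k" "y \<in> soc k" "x \<bullet> y = 0" for x y
  proof (cases "x = 0 \<or> y = 0")
    case False
    then obtain c where "c > 0" "y = c *\<^sub>R (Jmat k *v x)" "x \<in> frontier (soc k)"
      using xy orthogonal_in_soc by metis
    then show ?thesis using A[of x] by (simp add: mult_nonneg_nonpos)
  qed auto
  then show "A \<in> Z_trans (soc k)" unfolding Z_trans_def dual_cone_soc by blast
qed

lemma strict_Z_trans_soc: "strict_Z_trans (soc k) = neg_J_mult k -` form_pos (frontier (soc k))"
proof (intro set_eqI iffI)
  fix A assume A: "A \<in> strict_Z_trans (soc k)"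
  have "(A *v x) \<bullet> (Jmat k *v x) < 0" if x: "x \<in> frontier (soc k)" "x \<noteq> 0" for x
  proof -
    have "Jmat k *v x \<noteq> 0" using x(2) Jmat_involution_vec[of k x] by auto
    then show ?thesis
      using x A Jmat_frontier_soc[OF x(1)]
      unfolding strict_Z_trans_def by (auto simp: frontier_soc_iff soc_iff)
  qed
  then show "A \<in> neg_J_mult k -` form_pos (frontier (soc k))"
    by (simp add: form_pos_def neg_J_mult_form)
next
  fix A assume "A \<in> neg_J_mult k -` form_pos (frontier (soc k))"
  then have A: "(A *v x) \<bullet> (Jmat k *v x) < 0" if "x \<in> frontier (soc k)" "x \<noteq> 0" for x
    using that by (auto simp: form_pos_def neg_J_mult_form)
  have "(A *v x) \<bullet> y < 0"
    if xy: "x \<in> soc k" "y \<in> soc k" "x \<noteq> 0" "y \<noteq> 0" "x \<bullet> y = 0" for x y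
  proof -
    obtain c where "c > 0" "y = c *\<^sub>R (Jmat k *v x)" "x \<in> frontier (soc k)"
      using xy orthogonal_in_soc by metis
    then show ?thesis using A[of x] xy(3) by (simp add: mult_pos_neg)
  qed
  then show "A \<in> strict_Z_trans (soc k)" unfolding strict_Z_trans_def by blast
qed

section \<open>The parametrisation by symmetric and skew-symmetric matrices\<close>

text \<open>
  A condition \<open>X\<close> that only looks at the form on the boundary cannot distinguish \<open>- J A\<close>
  from the symmetric \<open>P\<close>; this covers the strict cone and the boundary at once.
\<close>

lemma parametrisation:
  assumes X: "\<And>B C. \<lbrakk>\<And>x. x \<in> frontier (soc k) \<Longrightarrow> x \<bullet> (B *v x) = x \<bullet> (C *v x); B \<in> X\<rbrakk> \<Longrightarrow> C \<in> X"
  shows "{\<theta> *\<^sub>R mat 1 - Jmat k ** (P + Q) | \<theta> P Q. P \<in> sym_matrices \<inter> X \<and> Q \<in> skew_matrices}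
    = neg_J_mult k -` X"
proof (intro set_eqI iffI)
  fix A
  assume "A \<in> {\<theta> *\<^sub>R mat 1 - Jmat k ** (P + Q) | \<theta> P Q. P \<in> sym_matrices \<inter> X \<and> Q \<in> skew_matrices}"
  then obtain \<theta> P Q where A: "A = \<theta> *\<^sub>R mat 1 - Jmat k ** (P + Q)"
    and P: "P \<in> X" and Q: "Q \<in> skew_matrices" by blast
  have "neg_J_mult k A *v x = P *v x + Q *v x - \<theta> *\<^sub>R (Jmat k *v x)" for x
    unfolding A neg_J_mult_vec
    by (simp add: matrix_vector_mult_diff_rdistrib scaleR_matrix_vector_mult
        matrix_vector_mult_diff_distrib matrix_vector_mult_scaleR Jmat_involution_vec
        matrix_vector_mult_add_rdistrib flip: matrix_vector_mul_assoc)
  then have "x \<bullet> (P *v x) = x \<bullet> (neg_J_mult k A *v x)" if "x \<in> frontier (soc k)" for x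
    using that quadratic_form_skew[OF Q, of x]
    by (simp add: inner_add_right inner_diff_right frontier_soc_iff)
  then show "A \<in> neg_J_mult k -` X" using X[OF _ P] by simp
next
  fix A assume A: "A \<in> neg_J_mult k -` X"
  define B where "B = neg_J_mult k A"
  define P where "P = (1/2) *\<^sub>R (B + transpose B)"
  define Q where "Q = (1/2) *\<^sub>R (B - transpose B)"
  have PQ: "P + Q = B"
    by (simp add: P_def Q_def vec_eq_iff field_simps)
  have "P \<in> sym_matrices"
    by (simp add: sym_matrices_def P_def transpose_def vec_eq_iff)
  moreover have Q: "Q \<in> skew_matrices"
    by (simp add: skew_matrices_def Q_def transpose_def vec_eq_iff field_simps)
  moreover have "x \<bullet> (B *v x) = x \<bullet> (P *v x)" for x
    using quadratic_form_skew[OF Q, of x]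
    by (simp flip: PQ add: matrix_vector_mult_add_rdistrib inner_add_right)
  then have "P \<in> X" using X[of B P] A by (simp add: B_def)
  moreover have "A = 0 *\<^sub>R mat 1 - Jmat k ** (P + Q)"
    unfolding PQ B_def using neg_J_mult_involution[of k A] by (simp add: neg_J_mult_def)
  ultimately show
    "A \<in> {\<theta> *\<^sub>R mat 1 - Jmat k ** (P + Q) | \<theta> P Q. P \<in> sym_matrices \<inter> X \<and> Q \<in> skew_matrices}"
    by blast
qed

theorem corollary3p3:
  fixes k :: "'n::finite"
  assumes "CARD('n) > 1"
  shows "interior (Z_trans (soc k)) = strict_Z_trans (soc k)
    \<and> strict_Z_trans (soc k) =
        {\<theta> *\<^sub>R mat 1 - Jmat k ** (P + Q) | \<theta> P Q.
           P \<in> strict_copositive (frontier (soc k)) \<and> Q \<in> skew_matrices}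
    \<and> frontier (Z_trans (soc k)) =
        {\<theta> *\<^sub>R mat 1 - Jmat k ** (P + Q) | \<theta> P Q.
           P \<in> top_of_set sym_matrices frontier_of copositive (frontier (soc k))
           \<and> Q \<in> skew_matrices}"
proof (intro conjI)
  let ?F = "frontier (soc k)"
  note cone = frontier_closed[of "soc k"] scaleR_frontier_soc[of _ _ k]
  have int: "interior (form_nonneg ?F) = form_pos ?F"
    using interior_of_form_nonneg[OF cone, of UNIV] by simp
  show interior: "interior (Z_trans (soc k)) = strict_Z_trans (soc k)"
    unfolding Z_trans_soc strict_Z_trans_soc interior_neg_J_mult_vimage int ..
  show "strict_Z_trans (soc k) =
      {\<theta> *\<^sub>R mat 1 - Jmat k ** (P + Q) | \<theta> P Q. P \<in> strict_copositive ?F \<and> Q \<in> skew_matrices}"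
    unfolding strict_Z_trans_soc strict_copositive_eq
    by (rule parametrisation[symmetric]) (auto simp: form_pos_def)
  have "closed (Z_trans (soc k))"
    unfolding Z_trans_soc
    by (intro closed_vimage closed_form_nonneg linear_continuous_on linear_linear[THEN iffD2]
        linear_neg_J_mult)
  then have "frontier (Z_trans (soc k)) = neg_J_mult k -` (form_nonneg ?F - form_pos ?F)"
    unfolding frontier_def[of "Z_trans (soc k)"] interior
    by (simp add: Z_trans_soc strict_Z_trans_soc vimage_Diff)
  also have "\<dots> = {\<theta> *\<^sub>R mat 1 - Jmat k ** (P + Q) | \<theta> P Q.
      P \<in> sym_matrices \<inter> (form_nonneg ?F - form_pos ?F) \<and> Q \<in> skew_matrices}"
    by (rule parametrisation[symmetric]) (auto simp: form_nonneg_def form_pos_def)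
  also have "sym_matrices \<inter> (form_nonneg ?F - form_pos ?F)
      = top_of_set sym_matrices frontier_of copositive ?F"
    unfolding copositive_eq
    by (rule frontier_of_form_nonneg[OF cone, symmetric])
      (auto simp: sym_matrices_def transpose_def mat_def vec_eq_iff)
  finally show "frontier (Z_trans (soc k)) =
      {\<theta> *\<^sub>R mat 1 - Jmat k ** (P + Q) | \<theta> P Q.
         P \<in> top_of_set sym_matrices frontier_of copositive ?F \<and> Q \<in> skew_matrices}" .
qed

end
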